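(* Let $n\ge 1$ and let $f:S_n\to\mathbb{C}$ be a function. Suppose that for all complex positive semidefinite $n\times n$ matrices $A=(a_{ij})$ it holds that $$d_f(A)=\sum_{\sigma\in S_n} f(\sigma)\prod_{t=1}^n a_{t\sigma(t)}\ \ge\ 0 .$$ Then for every $m\ge 1$ and all complex positive semidefinite $m\times m$ matrices $X_1,\dots,X_{n-1}$, the $m\times m$ matrix $$\widetilde d_f(X_1,\dots,X_{n-1})=\sum_{\sigma\in S_n} f(\sigma)\,\widetilde T_\sigma$$ is positive semidefinite, i.e. $\widetilde d_f(X_1,\dots,X_{n-1})\ge 0$ in the Löwner order. Here $\widetilde T_\sigma=\widetilde T_\sigma(X_1,\dots,X_{n-1})$ is the matrix defined in the context.
   Context: $S_n$ is the symmetric group on $\{1,\dots,n\}$. A complex matrix is positive semidefinite if it is Hermitian with nonnegative quadratic form; for matrices, $A\ge B$ means $A-B$ is positive semidefinite (Löwner order). The scalar condition $d_f(A)\ge 0$ means that $d_f(A)$ is real and nonnegative. Definition of $\widetilde T_\sigma$. Given complex $m\times m$ matrices $X_1,\dots,X_{n-1}$ and $\sigma\in S_n$, write $\sigma$ as a product of disjoint cycles (including cycles of length one), ordered so that the last cycle contains $n$ and is written with $n$ as its last entry: $$\sigma=(\alpha_1\cdots\alpha_r)\cdots(\zeta_1\cdots\zeta_t)(\xi_1\cdots\xi_w\, n),$$ where $(\alpha_1\cdots\alpha_r)$ denotes the cycle $\alpha_1\mapsto\alpha_2\mapsto\cdots\mapsto\alpha_r\mapsto\alpha_1$. Then $$\widetilde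 T_\sigma=\operatorname{tr}(X_{\alpha_1}\cdots X_{\alpha_r})\cdots\operatorname{tr}(X_{\zeta_1}\cdots X_{\zeta_t})\,X_{\xi_1}\cdots X_{\xi_w}\,\mathbb{1},$$ where $\mathbb{1}$ is the $m\times m$ identity matrix. That is, each cycle not containing $n$ contributes the trace of the corresponding ordered product, and the cycle containing $n$ contributes the ordered product $X_{\xi_1}\cdots X_{\xi_w}$ (equal to $\mathbb{1}$ if $n$ is a fixed point of $\sigma$, i.e. $w=0$). *)

theory Defs
  imports
    "Jordan_Normal_Form.Schur_Decomposition"
    "HOL-Combinatorics.Cycles"
begin

definition psd_mat :: "nat \<Rightarrow> complex mat \<Rightarrow> bool" where
  "psd_mat k A \<longleftrightarrow> A \<in> carrier_mat k k \<and> mat_adjoint A = A \<and>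
     (\<forall>v \<in> carrier_vec k. 0 \<le> (A *\<^sub>v v) \<bullet>c v)"

definition trace_mat :: "complex mat \<Rightarrow> complex" where
  "trace_mat A = (\<Sum>i<dim_row A. A $$ (i, i))"

definition word_mat :: "nat \<Rightarrow> (nat \<Rightarrow> complex mat) \<Rightarrow> nat list \<Rightarrow> complex mat" where
  "word_mat m X xs = foldr (\<lambda>i M. X i * M) xs (1\<^sub>m m)"

(* Permutations act on {1..n}, whereas matrix indices start at 0, so the entry a_{t s(t)} is
   A $$ (t - 1, s t - 1). *)
definition gen_mat_fun :: "nat \<Rightarrow> ((nat \<Rightarrow> nat) \<Rightarrow> complex) \<Rightarrow> complex mat \<Rightarrow> complex" where
  "gen_mat_fun n f A =
     (\<Sum>\<sigma> | \<sigma> permutes {1..n}. f \<sigma> * (\<Prod>t = 1..n. A $$ (t - 1, \<sigma> t - 1)))"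

(* support s i is the cycle of s through i, written as the list [i, s i, s (s i), ...].
   One starting point per cycle not containing n: the least element of the cycle. By cyclicity
   of the trace any other choice gives the same value (see T_tilde_cycle_notation). *)
definition cycle_starts :: "nat \<Rightarrow> (nat \<Rightarrow> nat) \<Rightarrow> nat set" where
  "cycle_starts n \<sigma> =
     {i \<in> {1..n}. n \<notin> set (support \<sigma> i) \<and> (\<forall>j \<in> set (support \<sigma> i). i \<le> j)}"

(* support s n = [n, xi_1, ..., xi_w] lists the same cycle as (xi_1 ... xi_w n). *)
definition T_tilde :: "nat \<Rightarrow> nat \<Rightarrow> (nat \<Rightarrow> complex mat) \<Rightarrow> (nat \<Rightarrow> nat) \<Rightarrow> complex mat" where
  "T_tilde n m X \<sigma> =
     (\<Prod>i \<in> cycle_starts n \<sigma>. trace_mat (word_mat m X (support \<sigma> i)))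
       \<cdot>\<^sub>m word_mat m X (tl (support \<sigma> n))"

definition d_tilde ::
    "nat \<Rightarrow> nat \<Rightarrow> ((nat \<Rightarrow> nat) \<Rightarrow> complex) \<Rightarrow> (nat \<Rightarrow> complex mat) \<Rightarrow> complex mat" where
  "d_tilde n m f X =
     (\<Oplus>\<^bsub>module_mat TYPE(complex) m m\<^esub> \<sigma> \<in> {\<sigma>. \<sigma> permutes {1..n}}. f \<sigma> \<cdot>\<^sub>m T_tilde n m X \<sigma>)"


lemma word_mat_carrier:
  assumes "\<And>i. i \<in> set xs \<Longrightarrow> X i \<in> carrier_mat m m"
  shows "word_mat m X xs \<in> carrier_mat m m"
  using assms by (induction xs) (auto simp: word_mat_def intro!: mult_carrier_mat)

lemma word_mat_append:
  assumes "\<And>i. i \<in> set xs \<union> set ys \<Longrightarrow> X i \<in> carrier_mat m m"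
  shows "word_mat m X (xs @ ys) = word_mat m X xs * word_mat m X ys"
  using assms
proof (induction xs)
  case Nil
  then show ?case using word_mat_carrier[of ys X m] by (simp add: word_mat_def)
next
  case (Cons x xs)
  have a: "X x \<in> carrier_mat m m" "word_mat m X xs \<in> carrier_mat m m"
     "word_mat m X ys \<in> carrier_mat m m"
    using Cons.prems by (auto intro!: word_mat_carrier)
  have "word_mat m X ((x # xs) @ ys) = X x * word_mat m X (xs @ ys)"
    by (simp add: word_mat_def)
  also have "word_mat m X (xs @ ys) = word_mat m X xs * word_mat m X ys"
    using Cons by auto
  also have "X x * (word_mat m X xs * word_mat m X ys) = (X x * word_mat m X xs) * word_mat m X ys"
    using a by simp
  finally show ?case by (simp add: word_mat_def)
qed

lemma trace_mat_mult_commute: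
  assumes "A \<in> carrier_mat m m" "B \<in> carrier_mat m m"
  shows "trace_mat (A * B) = trace_mat (B * A)"
proof -
  have "trace_mat (A * B) = (\<Sum>i<m. \<Sum>k<m. A $$ (i, k) * B $$ (k, i))"
    using assms by (auto simp: trace_mat_def scalar_prod_def atLeast0LessThan intro!: sum.cong)
  also have "\<dots> = (\<Sum>k<m. \<Sum>i<m. B $$ (k, i) * A $$ (i, k))"
    by (subst sum.swap) (simp add: mult.commute)
  also have "\<dots> = trace_mat (B * A)"
    using assms by (auto simp: trace_mat_def scalar_prod_def atLeast0LessThan intro!: sum.cong)
  finally show ?thesis .
qed

lemma trace_word_mat_rotate:
  assumes "\<And>i. i \<in> set xs \<Longrightarrow> X i \<in> carrier_mat m m" and "k \<le> length xs"
  shows "trace_mat (word_mat m X (rotate k xs)) = trace_mat (word_mat m X xs)"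
proof -
  have s: "set (drop k xs) \<subseteq> set xs" "set (take k xs) \<subseteq> set xs"
    by (auto dest: in_set_dropD in_set_takeD)
  have r: "rotate k xs = drop k xs @ take k xs"
    using assms(2) by (cases "k = length xs") (auto simp: rotate_drop_take)
  have "trace_mat (word_mat m X (rotate k xs)) =
      trace_mat (word_mat m X (drop k xs) * word_mat m X (take k xs))"
    unfolding r using s assms(1) by (subst word_mat_append) auto
  also have "\<dots> = trace_mat (word_mat m X (take k xs) * word_mat m X (drop k xs))"
    using s assms(1) by (intro trace_mat_mult_commute[of _ m] word_mat_carrier) auto
  also have "\<dots> = trace_mat (word_mat m X xs)"
    using s assms(1) by (subst word_mat_append[symmetric]) auto
  finally show ?thesis .
qed

lemma support_eq_rotate:
  assumes "distinct c" "k < length c"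
    and step: "\<And>j. j < length c \<Longrightarrow> \<sigma> (c ! j) = c ! (Suc j mod length c)"
  shows "support \<sigma> (c ! k) = rotate k c"
proof -
  have pow: "(\<sigma> ^^ i) (c ! k) = c ! ((k + i) mod length c)" for i
  proof (induction i)
    case 0 then show ?case using assms(2) by simp
  next
    case (Suc i)
    have "(k + i) mod length c < length c" using assms(2) by (intro mod_less_divisor) linarith
    then show ?case using Suc step[of "(k + i) mod length c"] by (simp add: mod_Suc_eq)
  qed
  have "least_power \<sigma> (c ! k) = length c"
    unfolding least_power_def
  proof (rule Least_equality)
    show "(\<sigma> ^^ length c) (c ! k) = c ! k \<and> 0 < length c"
    proof -
      have "(k + length c) mod length c = k" using assms(2) by simp
      moreover have "0 < length c" using assms(2) by linarith
      ultimately show ?thesis using pow[of "length c"] by metis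
    qed
  next
    fix i assume i: "(\<sigma> ^^ i) (c ! k) = c ! k \<and> 0 < i"
    then have "(k + i) mod length c = k"
      using pow[of i] assms(1,2)
      by (metis mod_less_divisor nth_eq_iff_index_eq less_nat_zero_code not_gr_zero)
    then have "length c dvd i"
      by (metis add_diff_cancel_left' dvd_minus_mod)
    then show "length c \<le> i" using i by (auto intro: dvd_imp_le)
  qed
  then show ?thesis
    by (intro nth_equalityI) (auto simp: pow nth_rotate)
qed

lemma T_tilde_cycle_notation:
  assumes dist: "distinct (concat cs @ xi @ [n])" "set (concat cs @ xi @ [n]) = {1..n}"
    and ne: "[] \<notin> set cs"
    and step: "\<And>c j. c \<in> insert (xi @ [n]) (set cs) \<Longrightarrow> j < length c \<Longrightarrow>
                 \<sigma> (c ! j) = c ! (Suc j mod length c)"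
    and X: "\<And>i. i \<in> {1..n-1} \<Longrightarrow> X i \<in> carrier_mat m m"
  shows "T_tilde n m X \<sigma> =
    (\<Prod>c\<leftarrow>cs. trace_mat (word_mat m X c)) \<cdot>\<^sub>m word_mat m X xi"
proof -
  have dc: "distinct c" if "c \<in> insert (xi @ [n]) (set cs)" for c
    using dist that by (auto simp: distinct_concat_iff)
  have sup: "\<exists>k < length c. support \<sigma> i = rotate k c"
    if "c \<in> insert (xi @ [n]) (set cs)" "i \<in> set c" for c i
    using support_eq_rotate[OF dc _ step, OF that(1) _ that(1)] that(2)
    by (metis in_set_conv_nth)
  have sset: "set (support \<sigma> i) = set c"
    if "c \<in> insert (xi @ [n]) (set cs)" "i \<in> set c" for c i
    using sup[OF that] by (metis set_rotate)
  have sn: "tl (support \<sigma> n) = xi"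
  proof -
    have "support \<sigma> ((xi @ [n]) ! length xi) = rotate (length xi) (xi @ [n])"
      by (rule support_eq_rotate[OF dc _ step]) auto
    then show ?thesis by (simp add: rotate_append)
  qed
  have dcs: "distinct cs"
    using dist(1) ne by (auto simp: distinct_concat_iff)
  have disj: "c = c'" if "c \<in> set cs" "c' \<in> set cs" "i \<in> set c" "i \<in> set c'" for c c' i
    using that dist(1) by (auto simp: distinct_concat_iff)
  have nn: "n \<notin> set c" if "c \<in> set cs" for c using that dist(1) by auto
  have sub: "set c \<subseteq> {1..n}" if "c \<in> set cs" for c using that dist(2) by auto
  have Mi: "Min (set c) \<in> set c" if "c \<in> set cs" for c
    using that ne by (intro Min_in) auto
  have starts: "cycle_starts n \<sigma> = (\<lambda>c. Min (set c)) ` set cs"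
  proof (intro equalityI subsetI)
    fix i assume i: "i \<in> cycle_starts n \<sigma>"
    then have "i \<in> set (concat cs @ xi @ [n])" using dist(2) by (auto simp: cycle_starts_def)
    moreover have "i \<notin> set (xi @ [n])"
      using i sset[of "xi @ [n]" i] by (auto simp: cycle_starts_def)
    ultimately obtain c where c: "c \<in> set cs" "i \<in> set c" by auto
    have "\<forall>j \<in> set c. i \<le> j"
      using i sset[OF _ c(2)] c(1) unfolding cycle_starts_def by blast
    then have "i = Min (set c)" using c(2) by (intro Min_eqI[symmetric]) auto
    then show "i \<in> (\<lambda>c. Min (set c)) ` set cs" using c by blast
  next
    fix i assume "i \<in> (\<lambda>c. Min (set c)) ` set cs"
    then obtain c where c: "c \<in> set cs" "i = Min (set c)" by blast
    then show "i \<in> cycle_starts n \<sigma>"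
    proof -
      have i: "i \<in> set c" using Mi c by simp
      have s: "set (support \<sigma> i) = set c" using sset[OF _ i] c(1) by simp
      have "\<forall>j \<in> set c. i \<le> j" using c(2) by simp
      moreover have "i \<in> {1..n}" using i sub[OF c(1)] by blast
      ultimately show ?thesis
        using nn[OF c(1)] unfolding cycle_starts_def mem_Collect_eq s by (intro conjI)
    qed
  qed
  have inj: "inj_on (\<lambda>c. Min (set c)) (set cs)"
  proof (rule inj_onI)
    fix c c' assume c: "c \<in> set cs" "c' \<in> set cs" "Min (set c) = Min (set c')"
    show "c = c'" using disj[OF c(1,2) Mi[OF c(1)]] Mi[OF c(2)] c(3) by simp
  qed
  have "(\<Prod>i \<in> cycle_starts n \<sigma>. trace_mat (word_mat m X (support \<sigma> i))) =
      (\<Prod>c \<in> set cs. trace_mat (word_mat m X (support \<sigma> (Min (set c)))))"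
    unfolding starts by (subst prod.reindex[OF inj]) simp
  also have "\<dots> = (\<Prod>c \<in> set cs. trace_mat (word_mat m X c))"
  proof (rule prod.cong[OF refl])
    fix c assume c: "c \<in> set cs"
    obtain k where k: "k < length c" "support \<sigma> (Min (set c)) = rotate k c"
      using sup[OF _ Mi[OF c]] c by auto
    have "X i \<in> carrier_mat m m" if "i \<in> set c" for i
    proof (rule X)
      have "i \<noteq> n" "i \<in> {1..n}" using that nn[OF c] sub[OF c] by auto
      then show "i \<in> {1..n-1}" by auto
    qed
    then show "trace_mat (word_mat m X (support \<sigma> (Min (set c)))) = trace_mat (word_mat m X c)"
      unfolding k(2) using k(1) by (intro trace_word_mat_rotate) auto
  qed
  also have "\<dots> = (\<Prod>c\<leftarrow>cs. trace_mat (word_mat m X c))"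
    using dcs by (simp add: prod.distinct_set_conv_list)
  finally show ?thesis unfolding T_tilde_def sn by simp
qed

end

theory Submission
  imports Defs
begin

text \<open>
  Fix a vector \<open>v\<close> and put \<open>X\<^sub>n = v v\<^sup>*\<close>. Then \<open>v\<^sup>* X\<^bsub>\<xi>\<^sub>1\<^esub> \<cdots> X\<^bsub>\<xi>\<^sub>w\<^esub> v\<close> is the trace of the product
  of the \<open>X\<close> along the whole cycle of \<open>n\<close>, so \<open>v\<^sup>* T\<^sub>\<sigma> v\<close> is a product of such traces over \<open>all\<close> cycles of
  \<open>\<sigma>\<close>. Writing traces as sums over closed paths, this product becomes
  \<open>\<Sum>p. \<Prod>t. (X\<^sub>t)(p t, p (\<sigma> t))\<close>, the sum over all labellings \<open>p\<close> of \<open>{1..n}\<close> by matrix indices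
  (lemma \<open>quad_form_T_tilde\<close>).

  Every \<open>X\<^sub>t\<close>, including \<open>X\<^sub>n\<close>, is a sum of rank one matrices \<open>u u\<^sup>*\<close>
  (lemma \<open>psd_mat_sum_rank_one\<close>). Expanding by multilinearity and summing over the labels
  leaves, for each choice of one vector \<open>u\<^sub>t\<close> per \<open>t\<close>, the product of the inner products of \<open>u\<^sub>t\<close>
  with \<open>u\<^bsub>\<sigma> t\<^esub>\<close>: the term of \<open>\<sigma>\<close> in the generalized matrix function of the Gram matrix of the chosen
  vectors (lemma \<open>sum_paths_eq_sum_gram\<close>). Hence \<open>v\<^sup>* d(X) v\<close> is a sum of values of
  \<open>gen_mat_fun n f\<close> at Gram matrices. These are positive semidefinite, so the hypothesis makes each
  summand nonnegative, and a complex matrix whose quadratic form is nonnegative is positive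
  semidefinite.
\<close>

section \<open>Positive semidefinite matrices as sums of rank one matrices\<close>

lemma mat_adjoint_entry:
  assumes "A \<in> carrier_mat m m" "i < m" "j < m"
  shows "mat_adjoint A $$ (i, j) = cnj (A $$ (j, i))"
  using assms by (simp add: mat_adjoint_def mat_of_rows_index)

lemma quad_form_entries:
  assumes "A \<in> carrier_mat m m"
  shows "(A *\<^sub>v vec m g) \<bullet>c vec m g = (\<Sum>i<m. \<Sum>j<m. cnj (g i) * A $$ (i, j) * g j)"
  using assms
  by (simp add: scalar_prod_def atLeast0LessThan sum_distrib_left sum_distrib_right mult_ac)

text \<open>
  Over the complex numbers the form alone decides: its values at \<open>e\<^sub>a + z e\<^sub>b\<close> for
  \<open>z \<in> {0, 1, -1, \<i>, -\<i>}\<close> being real already forces the two entries at \<open>(a, b)\<close> and \<open>(b, a)\<close>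
  to be conjugate. So only quadratic forms have to be studied below.
\<close>
lemma psd_matI:
  assumes A: "A \<in> carrier_mat m m"
    and form: "\<And>v. v \<in> carrier_vec m \<Longrightarrow> 0 \<le> (A *\<^sub>v v) \<bullet>c v"
  shows "psd_mat m A"
proof -
  have herm: "cnj (A $$ (b, a)) = A $$ (a, b)" if "a < m" "b < m" for a b
  proof -
    have F: "0 \<le> A $$ (a, a) + z * A $$ (a, b) + cnj z * A $$ (b, a) + z * cnj z * A $$ (b, b)" for z
    proof -
      define g where "g i = (if i = a then 1 else 0) + (if i = b then z else 0)" for i
      have "(\<Sum>j<m. cnj (g i) * A $$ (i, j) * g j) = cnj (g i) * (A $$ (i, a) + z * A $$ (i, b))" for i
        unfolding g_def using that
        by (simp add: distrib_left sum.distrib mult.assoc if_distrib[where f = "\<lambda>x. _ * x"] cong: if_cong)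
      moreover have "(\<Sum>i<m. cnj (g i) * h i) = h a + cnj z * h b" for h :: "nat \<Rightarrow> complex"
        unfolding g_def using that
        by (simp add: distrib_right sum.distrib if_distrib[where f = cnj]
              if_distrib[where f = "\<lambda>x. x * _"] cong: if_cong)
      ultimately have "(A *\<^sub>v vec m g) \<bullet>c vec m g
          = A $$ (a, a) + z * A $$ (a, b) + cnj z * (A $$ (b, a) + z * A $$ (b, b))"
        by (simp add: quad_form_entries[OF A])
      then show ?thesis using form[of "vec m g"] by (simp add: algebra_simps)
    qed
    show ?thesis
      using F[of 0] F[of 1] F[of "-1"] F[of \<i>] F[of "- \<i>"]
      by (simp add: less_eq_complex_def complex_eq_iff)
  qed
  have "mat_adjoint A = A"
  proof (rule eq_matI)
    show "mat_adjoint A $$ (i, j) = A $$ (i, j)" if "i < dim_row A" "j < dim_col A" for i j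
      using that A herm[of i j] by (simp add: mat_adjoint_entry[OF A])
  qed (use A in \<open>auto simp: mat_adjoint_def\<close>)
  then show ?thesis using A form by (simp add: psd_mat_def)
qed

text \<open>
  Cholesky elimination. With \<open>d = K m m\<close>, subtracting \<open>w w\<^sup>*\<close> for \<open>w = K(\<cdot>, m) / \<surd>d\<close> clears the
  last row and column, and what remains on \<open>{..<m}\<close> is the Schur complement, which is again positive
  semidefinite, so induction applies. If \<open>d = 0\<close>, positivity forces the last row and column to vanish
  beforehand; then \<open>w = 0\<close> because division by zero yields zero, and the same formulas cover both cases.
  Kernels on \<open>nat\<close> are used instead of matrices so that the induction can keep the index type
  while the dimension drops.
\<close>
lemma psd_kernel_sum_rank_one:
  fixes K :: "nat \<Rightarrow> nat \<Rightarrow> complex"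
  assumes "\<And>i j. i < m \<Longrightarrow> j < m \<Longrightarrow> K j i = cnj (K i j)"
    and "\<And>v. 0 \<le> (\<Sum>i<m. \<Sum>j<m. cnj (v i) * K i j * v j)"
  shows "\<exists>u. \<forall>i<m. \<forall>j<m. K i j = (\<Sum>k<m. u k i * cnj (u k j))"
  using assms
proof (induction m arbitrary: K)
  case 0
  then show ?case by simp
next
  case (Suc m)
  define Q where "Q v = (\<Sum>i<m. \<Sum>j<m. cnj (v i) * K i j * v j)" for v
  define S where "S v = (\<Sum>j<m. K m j * v j)" for v
  have herm: "cnj (K i j) = K j i" if "i \<le> m" "j \<le> m" for i j
    using Suc.prems(1)[of i j] that by simp
  have form: "0 \<le> Q v + cnj (v m) * S v + cnj (S v) * v m + cnj (v m) * K m m * v m" for v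
  proof -
    have "cnj (S v) * v m = (\<Sum>i<m. cnj (v i) * K i m * v m)"
      unfolding S_def cnj_sum sum_distrib_right
      by (rule sum.cong) (simp_all add: herm)
    then have "(\<Sum>i<Suc m. \<Sum>j<Suc m. cnj (v i) * K i j * v j)
        = Q v + cnj (v m) * S v + cnj (S v) * v m + cnj (v m) * K m m * v m"
      by (simp add: Q_def S_def sum.distrib sum_distrib_left mult.assoc add_ac)
    then show ?thesis using Suc.prems(2)[of v] by (simp only:)
  qed
  define d where "d = Re (K m m)"
  have d: "d \<ge> 0" and Kmm: "K m m = complex_of_real d"
  proof -
    have "0 \<le> K m m" using form[of "\<lambda>i. if i = m then 1 else 0"] by (simp add: Q_def S_def)
    then show "d \<ge> 0" "K m m = complex_of_real d"
      by (auto simp: d_def less_eq_complex_def complex_eq_iff)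
  qed
  have zero: "K i m = 0" if "d = 0" "i \<le> m" for i
  proof (rule ccontr)
    assume nz: "K i m \<noteq> 0"
    then have im: "i < m" using that Kmm by (cases "i = m") auto
    define a where "a = Re (K i i)"
    have a: "K i i = complex_of_real a"
      using arg_cong[OF herm[of i i], of Im] im by (simp add: a_def complex_eq_iff)
    \<comment> \<open>At \<open>v\<close> the form equals \<open>a - 2 c |K i m|\<^sup>2\<close>, and \<open>c\<close> is chosen to make this \<open>-1\<close>.\<close>
    define c where "c = (a + 1) / (2 * (cmod (K i m))\<^sup>2)"
    define v where "v j = (if j = i then 1 else if j = m then - of_real c * cnj (K i m) else 0)" for j
    have vm: "v m = - of_real c * cnj (K i m)" using im by (simp add: v_def)
    have S: "S v = K m i"
      unfolding S_def using im by (subst sum.remove[of _ i]) (auto simp: v_def intro!: sum.neutral)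
    have Qi: "(\<Sum>j<m. cnj (v l) * K l j * v j) = cnj (v l) * K l i" for l
      using im by (subst sum.remove[of _ i]) (auto simp: v_def intro!: sum.neutral)
    have Q: "Q v = K i i"
      unfolding Q_def Qi using im by (subst sum.remove[of _ i]) (auto simp: v_def intro!: sum.neutral)
    have "0 \<le> K i i + cnj (v m) * K m i + cnj (K m i) * v m"
      using form[of v] Kmm that(1) unfolding S Q by simp
    also have "\<dots> = complex_of_real (a - 2 * c * (cmod (K i m))\<^sup>2)"
    proof -
      have "K m i = cnj (K i m)" using herm[of i m] im by simp
      then have "K i i + cnj (v m) * K m i + cnj (K m i) * v m
          = of_real a - 2 * of_real c * (K i m * cnj (K i m))"
        unfolding vm a by (simp add: algebra_simps)
      then show ?thesis unfolding complex_norm_square[symmetric] by simp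
    qed
    finally have "0 \<le> a - 2 * c * (cmod (K i m))\<^sup>2" by (simp add: less_eq_complex_def)
    moreover have "2 * c * (cmod (K i m))\<^sup>2 = a + 1" using nz by (simp add: c_def)
    ultimately show False by simp
  qed
  define w where "w i = K i m / complex_of_real (sqrt d)" for i
  have wS: "(\<Sum>j<m. cnj (w j) * v j) = S v / complex_of_real (sqrt d)" for v
    unfolding S_def sum_divide_distrib
    by (rule sum.cong) (simp_all add: w_def herm)
  have "\<exists>u. \<forall>i<m. \<forall>j<m. K i j - w i * cnj (w j) = (\<Sum>k<m. u k i * cnj (u k j))"
  proof (rule Suc.IH)
    show "K j i - w j * cnj (w i) = cnj (K i j - w i * cnj (w j))" if "i < m" "j < m" for i j
      using that by (simp add: herm)
    show "0 \<le> (\<Sum>i<m. \<Sum>j<m. cnj (v i) * (K i j - w i * cnj (w j)) * v j)" for v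
    proof -
      \<comment> \<open>The last coordinate of \<open>z\<close> minimizes the form; the minimum is the form of the Schur complement.\<close>
      define z where "z = v(m := - S v / of_real d)"
      have z: "Q z = Q v" "S z = S v" "z m = - S v / of_real d"
        by (auto simp: Q_def S_def z_def)
      have "Q z + cnj (z m) * S z + cnj (S z) * z m + cnj (z m) * K m m * z m
          = Q v - S v * cnj (S v) / of_real d"
        unfolding z Kmm by (cases "d = 0") (simp_all add: field_simps)
      then have "0 \<le> Q v - S v * cnj (S v) / of_real d"
        using form[of z] by (simp only:)
      also have "S v * cnj (S v) / of_real d
          = (\<Sum>i<m. cnj (v i) * w i) * (\<Sum>j<m. cnj (w j) * v j)"
      proof -
        have "(\<Sum>i<m. cnj (v i) * w i) = cnj (\<Sum>j<m. cnj (w j) * v j)" 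
          by (simp add: cnj_sum mult.commute)
        moreover have "complex_of_real (sqrt d) * complex_of_real (sqrt d) = of_real d"
          using d by (simp flip: of_real_mult)
        ultimately show ?thesis unfolding wS by (simp add: mult.commute)
      qed
      also have "Q v - \<dots> = (\<Sum>i<m. \<Sum>j<m. cnj (v i) * (K i j - w i * cnj (w j)) * v j)"
        unfolding Q_def sum_product sum_subtractf[symmetric]
        by (intro sum.cong refl) (simp add: algebra_simps)
      finally show ?thesis .
    qed
  qed
  then obtain u where u: "\<And>i j. i < m \<Longrightarrow> j < m \<Longrightarrow>
      K i j - w i * cnj (w j) = (\<Sum>k<m. u k i * cnj (u k j))" by blast
  have wm: "w i * cnj (w m) = K i m" "w m * cnj (w i) = K m i" if "i \<le> m" for i
  proof -
    have "w m = of_real (sqrt d)" using d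
      by (simp add: w_def Kmm real_div_sqrt flip: of_real_divide)
    moreover have "w i * of_real (sqrt d) = K i m" using zero[OF _ that] by (simp add: w_def)
    ultimately show *: "w i * cnj (w m) = K i m" by simp
    show "w m * cnj (w i) = K m i" 
      using arg_cong[OF *, of cnj] that by (simp add: herm mult.commute)
  qed
  define u' where "u' k i = (if k = m then w i else if i = m then 0 else u k i)" for k i
  have "K i j = (\<Sum>k<Suc m. u' k i * cnj (u' k j))" if "i < Suc m" "j < Suc m" for i j
  proof (cases "i = m \<or> j = m")
    case True
    then have "(\<Sum>k<m. u' k i * cnj (u' k j)) = 0" by (auto simp: u'_def)
    then show ?thesis using True wm that by (auto simp: u'_def)
  next
    case False
    then have "(\<Sum>k<m. u' k i * cnj (u' k j)) = (\<Sum>k<m. u k i * cnj (u k j))"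
      by (intro sum.cong) (auto simp: u'_def)
    then show ?thesis using False u[of i j] that by (simp add: u'_def diff_eq_eq)
  qed
  then show ?case by blast
qed

lemma psd_mat_sum_rank_one:
  assumes "psd_mat m A"
  shows "\<exists>u. \<forall>i<m. \<forall>j<m. A $$ (i, j) = (\<Sum>k<m. u k i * cnj (u k j))"
proof (rule psd_kernel_sum_rank_one)
  have A: "A \<in> carrier_mat m m" "mat_adjoint A = A" using assms by (auto simp: psd_mat_def)
  show "A $$ (j, i) = cnj (A $$ (i, j))" if "i < m" "j < m" for i j
    using mat_adjoint_entry[OF A(1) that(2,1)] A(2) by simp
  show "0 \<le> (\<Sum>i<m. \<Sum>j<m. cnj (v i) * A $$ (i, j) * v j)" for v
    using assms by (simp add: psd_mat_def flip: quad_form_entries[OF A(1)])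
qed

section \<open>Gram matrices\<close>

text \<open>
  The Gram matrix of \<open>w 1, \<dots>, w n\<close>, shifted because the vectors are numbered like the points
  that permutations act on, whereas matrix indices start at 0.
\<close>
definition gram_mat :: "nat \<Rightarrow> nat \<Rightarrow> (nat \<Rightarrow> nat \<Rightarrow> complex) \<Rightarrow> complex mat" where
  "gram_mat n m w = mat n n (\<lambda>(a, b). \<Sum>i<m. cnj (w (Suc a) i) * w (Suc b) i)"

text \<open>
  The form at \<open>v\<close> is the squared norm of \<open>\<Sum>b. v\<^sub>b w\<^sub>b\<close>.
\<close>
lemma psd_gram_mat: "psd_mat n (gram_mat n m w)"
proof (rule psd_matI)
  show G: "gram_mat n m w \<in> carrier_mat n n" by (simp add: gram_mat_def)
  fix v :: "complex vec" assume "v \<in> carrier_vec n"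
  then have v: "v = vec n (($) v)" by auto
  define h where "h i = (\<Sum>b<n. w (Suc b) i * v $ b)" for i
  have "(gram_mat n m w *\<^sub>v vec n (($) v)) \<bullet>c vec n (($) v)
      = (\<Sum>a<n. \<Sum>b<n. \<Sum>i<m. cnj (w (Suc a) i * v $ a) * (w (Suc b) i * v $ b))"
    unfolding quad_form_entries[OF G]
    by (simp add: gram_mat_def sum_distrib_left sum_distrib_right mult_ac)
  also have "\<dots> = (\<Sum>i<m. \<Sum>a<n. \<Sum>b<n. cnj (w (Suc a) i * v $ a) * (w (Suc b) i * v $ b))"
    by (subst sum.swap[of _ "{..<m}"], subst sum.swap[of _ "{..<m}"]) (rule refl)
  also have "\<dots> = (\<Sum>i<m. cnj (h i) * h i)"
    unfolding h_def cnj_sum sum_product ..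
  also have "\<dots> = complex_of_real (\<Sum>i<m. (cmod (h i))\<^sup>2)"
    unfolding of_real_sum complex_norm_square by (simp add: mult.commute)
  also have "0 \<le> \<dots>" by (simp add: less_eq_complex_def sum_nonneg)
  finally show "0 \<le> (gram_mat n m w *\<^sub>v v) \<bullet>c v" using v by simp
qed

text \<open>
  Writing every \<open>Y t\<close> as a sum of rank one terms and expanding the product, one term \<open>u t (k t)\<close> is
  chosen for each \<open>t\<close>. For a fixed choice the variable \<open>p s\<close> occurs in just two factors: in that of
  \<open>t = s\<close> as row index and in that of \<open>t = \<sigma>\<^sup>-\<^sup>1 s\<close> as column index. Summing it out leaves the
  inner product of the two chosen vectors, which is an entry of their Gram matrix. The Gram matrices
  do not depend on \<open>\<sigma>\<close>, which is what makes a sum over \<open>\<sigma>\<close> a sum of values of a generalized matrix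
  function.
\<close>
lemma sum_paths_eq_sum_gram:
  assumes \<sigma>: "\<sigma> permutes {1..n}"
    and Y: "\<And>t i j. t \<in> {1..n} \<Longrightarrow> i < m \<Longrightarrow> j < m \<Longrightarrow>
          Y t $$ (i, j) = (\<Sum>k<m. u t k i * cnj (u t k j))"
  shows "(\<Sum>p \<in> {1..n} \<rightarrow>\<^sub>E {..<m}. \<Prod>t = 1..n. Y t $$ (p t, p (\<sigma> t)))
    = (\<Sum>k \<in> {1..n} \<rightarrow>\<^sub>E {..<m}. \<Prod>t = 1..n. gram_mat n m (\<lambda>t. u t (k t)) $$ (t - 1, \<sigma> t - 1))"
proof -
  let ?P = "{1..n} \<rightarrow>\<^sub>E {..<m}"
  have inS: "\<sigma> t \<in> {1..n}" if "t \<in> {1..n}" for t using permutes_in_image[OF \<sigma>] that by simp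
  define \<tau> where "\<tau> = inv_into UNIV \<sigma>"
  have \<tau>: "\<tau> (\<sigma> t) = t" "\<sigma> (\<tau> t) = t" for t
    unfolding \<tau>_def by (rule permutes_inverses[OF \<sigma>])+
  have shift: "(\<Prod>t = 1..n. g (\<sigma> t)) = (\<Prod>t = 1..n. g t)" for g :: "nat \<Rightarrow> complex"
    using prod.permute[OF \<sigma>, of g] by (simp add: o_def)
  have "(\<Sum>p \<in> ?P. \<Prod>t = 1..n. Y t $$ (p t, p (\<sigma> t)))
      = (\<Sum>p \<in> ?P. \<Prod>t = 1..n. \<Sum>k<m. u t k (p t) * cnj (u t k (p (\<sigma> t))))"
    using inS by (intro sum.cong prod.cong refl Y) (auto simp: PiE_iff)
  also have "\<dots> = (\<Sum>p \<in> ?P. \<Sum>k \<in> ?P. \<Prod>t = 1..n. u t (k t) (p t) * cnj (u t (k t) (p (\<sigma> t))))"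
    by (subst prod_sum_PiE) auto
  also have "\<dots> = (\<Sum>k \<in> ?P. \<Sum>p \<in> ?P. \<Prod>t = 1..n. u t (k t) (p t) * cnj (u t (k t) (p (\<sigma> t))))"
    by (rule sum.swap)
  also have "\<dots> = (\<Sum>k \<in> ?P. \<Prod>t = 1..n. gram_mat n m (\<lambda>t. u t (k t)) $$ (t - 1, \<sigma> t - 1))"
  proof (rule sum.cong[OF refl])
    fix k
    define w where "w t = u t (k t)" for t
    have "(\<Sum>p \<in> ?P. \<Prod>t = 1..n. w t (p t) * cnj (w t (p (\<sigma> t))))
        = (\<Sum>p \<in> ?P. \<Prod>t = 1..n. w (\<sigma> t) (p (\<sigma> t)) * cnj (w t (p (\<sigma> t))))"
      unfolding prod.distrib by (subst shift) (rule refl)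
    also have "\<dots> = (\<Sum>p \<in> ?P. \<Prod>t = 1..n. w t (p t) * cnj (w (\<tau> t) (p t)))"
    proof (rule sum.cong[OF refl])
      fix p :: "nat \<Rightarrow> nat"
      show "(\<Prod>t = 1..n. w (\<sigma> t) (p (\<sigma> t)) * cnj (w t (p (\<sigma> t))))
          = (\<Prod>t = 1..n. w t (p t) * cnj (w (\<tau> t) (p t)))"
        using shift[of "\<lambda>t. w t (p t) * cnj (w (\<tau> t) (p t))"]
        by (simp add: \<tau>)
    qed
    also have "\<dots> = (\<Prod>t = 1..n. \<Sum>i<m. w t i * cnj (w (\<tau> t) i))"
      by (subst prod_sum_PiE) auto
    also have "\<dots> = (\<Prod>t = 1..n. \<Sum>i<m. w (\<sigma> t) i * cnj (w t i))"
      using shift[of "\<lambda>t. \<Sum>i<m. w t i * cnj (w (\<tau> t) i)"]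
      by (simp add: \<tau>)
    also have "\<dots> = (\<Prod>t = 1..n. gram_mat n m w $$ (t - 1, \<sigma> t - 1))"
    proof (rule prod.cong[OF refl])
      fix t assume t: "t \<in> {1..n}"
      have "t - 1 < n" "\<sigma> t - 1 < n" "Suc (t - 1) = t" "Suc (\<sigma> t - 1) = \<sigma> t"
        using t inS[OF t] by auto
      then show "(\<Sum>i<m. w (\<sigma> t) i * cnj (w t i)) = gram_mat n m w $$ (t - 1, \<sigma> t - 1)"
        by (simp add: gram_mat_def mult.commute)
    qed
    finally show "(\<Sum>p \<in> ?P. \<Prod>t = 1..n. u t (k t) (p t) * cnj (u t (k t) (p (\<sigma> t))))
        = (\<Prod>t = 1..n. gram_mat n m (\<lambda>t. u t (k t)) $$ (t - 1, \<sigma> t - 1))"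
      unfolding w_def .
  qed
  finally show ?thesis .
qed

section \<open>Sums over labellings\<close>

lemma sum_PiE_Un_product:
  fixes g h :: "('a \<Rightarrow> 'b) \<Rightarrow> 'c :: comm_semiring_0"
  assumes "A \<inter> B = {}"
    and g: "\<And>p q. (\<And>x. x \<in> A \<Longrightarrow> p x = q x) \<Longrightarrow> g p = g q"
    and h: "\<And>p q. (\<And>x. x \<in> B \<Longrightarrow> p x = q x) \<Longrightarrow> h p = h q"
  shows "(\<Sum>p \<in> A \<union> B \<rightarrow>\<^sub>E T. g p * h p) = (\<Sum>p \<in> A \<rightarrow>\<^sub>E T. g p) * (\<Sum>q \<in> B \<rightarrow>\<^sub>E T. h q)"
proof -
  have "(\<Sum>p \<in> A \<union> B \<rightarrow>\<^sub>E T. g p * h p) = (\<Sum>(p, q) \<in> (A \<rightarrow>\<^sub>E T) \<times> (B \<rightarrow>\<^sub>E T). g p * h q)"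
  proof (rule sum.reindex_bij_witness
      [where i = "\<lambda>(p, q) x. if x \<in> A then p x else q x" and j = "\<lambda>p. (restrict p A, restrict p B)"])
    fix p assume "p \<in> A \<union> B \<rightarrow>\<^sub>E T"
    then show "(case (restrict p A, restrict p B) of (p, q) \<Rightarrow> \<lambda>x. if x \<in> A then p x else q x) = p"
      by (auto simp: fun_eq_iff PiE_def extensional_def)
    show "(case (restrict p A, restrict p B) of (p, q) \<Rightarrow> g p * h q) = g p * h p"
      using g[of "restrict p A" p] h[of "restrict p B" p] by simp
  next
    fix z assume "z \<in> (A \<rightarrow>\<^sub>E T) \<times> (B \<rightarrow>\<^sub>E T)"
    then show "(restrict ((\<lambda>(p, q) x. if x \<in> A then p x else q x) z) A,
        restrict ((\<lambda>(p, q) x. if x \<in> A then p x else q x) z) B) = z"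
      using assms(1) by (fastforce simp: fun_eq_iff PiE_def extensional_def restrict_def)
  qed (auto simp: PiE_def extensional_def)
  then show ?thesis by (simp add: sum_product sum.cartesian_product)
qed

text \<open>
  A labelling of a disjoint union is a tuple of labellings of its blocks, so a sum over labellings
  factorizes when each factor only looks at its own block. The blocks will be the cycles of a
  permutation.
\<close>
lemma sum_PiE_partition:
  fixes G :: "'i \<Rightarrow> ('a \<Rightarrow> 'b) \<Rightarrow> 'c :: comm_semiring_1"
  assumes "finite I" and "disjoint_family_on B I"
    and "\<And>i p q. i \<in> I \<Longrightarrow> (\<And>x. x \<in> B i \<Longrightarrow> p x = q x) \<Longrightarrow> G i p = G i q"
  shows "(\<Sum>p \<in> (\<Union>i\<in>I. B i) \<rightarrow>\<^sub>E T. \<Prod>i\<in>I. G i p) = (\<Prod>i\<in>I. \<Sum>p \<in> B i \<rightarrow>\<^sub>E T. G i p)"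
  using assms
proof (induction I rule: finite_induct)
  case empty
  then show ?case by simp
next
  case (insert i I)
  have "(\<Sum>p \<in> (\<Union>i\<in>insert i I. B i) \<rightarrow>\<^sub>E T. \<Prod>i\<in>insert i I. G i p)
      = (\<Sum>p \<in> B i \<union> (\<Union>i\<in>I. B i) \<rightarrow>\<^sub>E T. G i p * (\<Prod>i\<in>I. G i p))"
    using insert.hyps by simp
  also have "\<dots> = (\<Sum>p \<in> B i \<rightarrow>\<^sub>E T. G i p) * (\<Sum>p \<in> (\<Union>i\<in>I. B i) \<rightarrow>\<^sub>E T. \<Prod>i\<in>I. G i p)"
  proof (rule sum_PiE_Un_product)
    have "B i \<inter> B k = {}" if "k \<in> I" for k
      using that insert.hyps by (intro disjoint_family_onD[OF insert.prems(1)]) auto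
    then show "B i \<inter> (\<Union>i\<in>I. B i) = {}" by blast
    show "G i p = G i q" if "\<And>x. x \<in> B i \<Longrightarrow> p x = q x" for p q
      using insert.prems(2)[of i p q] that by simp
    show "(\<Prod>i\<in>I. G i p) = (\<Prod>i\<in>I. G i q)" if "\<And>x. x \<in> (\<Union>i\<in>I. B i) \<Longrightarrow> p x = q x" for p q
      by (intro prod.cong refl insert.prems(2)) (use that in blast)+
  qed
  also have "(\<Sum>p \<in> (\<Union>i\<in>I. B i) \<rightarrow>\<^sub>E T. \<Prod>i\<in>I. G i p) = (\<Prod>i\<in>I. \<Sum>p \<in> B i \<rightarrow>\<^sub>E T. G i p)"
  proof (rule insert.IH)
    show "disjoint_family_on B I"
      using insert.prems(1) by (simp add: disjoint_family_on_def)
    show "G k p = G k q" if "k \<in> I" "\<And>x. x \<in> B k \<Longrightarrow> p x = q x" for k p q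
      using that by (intro insert.prems(2)) blast+
  qed
  finally show ?case using insert.hyps by simp
qed

lemma sum_PiE_insert:
  fixes g :: "('a \<Rightarrow> 'b) \<Rightarrow> 'c :: comm_monoid_add"
  assumes "x \<notin> A"
  shows "(\<Sum>p \<in> insert x A \<rightarrow>\<^sub>E T. g p) = (\<Sum>y\<in>T. \<Sum>p \<in> A \<rightarrow>\<^sub>E T. g (p(x := y)))"
proof -
  have "inj_on (\<lambda>(y, g). g(x := y)) (T \<times> (A \<rightarrow>\<^sub>E T))"
    using assms by (rule inj_combinator)
  then show ?thesis
    unfolding PiE_insert_eq
    by (subst sum.reindex) (simp_all add: sum.cartesian_product case_prod_unfold)
qed

section \<open>Traces of words as sums over closed paths\<close>

text \<open>
  The weight of the path through the states \<open>p x\<close> (for \<open>x\<close> along the list) that ends in the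
  state \<open>j\<close>.
\<close>
fun path_weight :: "(nat \<Rightarrow> complex mat) \<Rightarrow> (nat \<Rightarrow> nat) \<Rightarrow> nat \<Rightarrow> nat list \<Rightarrow> complex" where
  "path_weight X p j [] = 1"
| "path_weight X p j [x] = X x $$ (p x, j)"
| "path_weight X p j (x # y # xs) = X x $$ (p x, p y) * path_weight X p j (y # xs)"

lemma path_weight_cong:
  assumes "\<And>x. x \<in> set xs \<Longrightarrow> p x = q x"
  shows "path_weight X p j xs = path_weight X q j xs"
  using assms by (induction X p j xs rule: path_weight.induct) auto

lemma word_mat_Cons: "word_mat m X (x # xs) = X x * word_mat m X xs"
  by (simp add: word_mat_def)

lemma word_mat_cong:
  assumes "\<And>x. x \<in> set xs \<Longrightarrow> X x = Y x"
  shows "word_mat m X xs = word_mat m Y xs"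
  using assms by (induction xs) (auto simp: word_mat_def)

text \<open>
  Entries of a product of matrices are sums over paths. As the letters are distinct, a path can be
  recorded as a labelling of the letters instead of the positions. The first state is fixed to be
  the row index.
\<close>
lemma word_mat_entry:
  assumes "distinct (x # xs)" "\<And>t. t \<in> set (x # xs) \<Longrightarrow> X t \<in> carrier_mat m m" "i < m" "j < m"
  shows "word_mat m X (x # xs) $$ (i, j)
    = (\<Sum>p \<in> set xs \<rightarrow>\<^sub>E {..<m}. path_weight X (p(x := i)) j (x # xs))"
  using assms
proof (induction xs arbitrary: x i)
  case Nil
  then show ?case by (simp add: word_mat_def)
next
  case (Cons y xs)
  have W: "word_mat m X (y # xs) \<in> carrier_mat m m"
    using Cons.prems(2) by (intro word_mat_carrier) auto
  have Xx: "X x \<in> carrier_mat m m" using Cons.prems(2) by simp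
  have "word_mat m X (x # y # xs) $$ (i, j)
      = (\<Sum>l<m. X x $$ (i, l) * word_mat m X (y # xs) $$ (l, j))"
    using W Xx Cons.prems(3,4)
    unfolding word_mat_Cons[of m X x] by (simp add: scalar_prod_def atLeast0LessThan)
  also have "\<dots> = (\<Sum>l<m. X x $$ (i, l) *
      (\<Sum>p \<in> set xs \<rightarrow>\<^sub>E {..<m}. path_weight X (p(y := l)) j (y # xs)))"
    using Cons.prems by (intro sum.cong arg_cong2[where f = "(*)"] refl Cons.IH) auto
  also have "\<dots> = (\<Sum>l<m. \<Sum>p \<in> set xs \<rightarrow>\<^sub>E {..<m}.
      path_weight X (p(y := l, x := i)) j (x # y # xs))"
  proof -
    have "path_weight X (p(y := l, x := i)) j (y # xs) = path_weight X (p(y := l)) j (y # xs)" for p l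
      using Cons.prems(1) by (intro path_weight_cong) auto
    then show ?thesis using Cons.prems(1) by (simp add: sum_distrib_left del: fun_upd_apply) 
       (auto intro!: sum.cong)
  qed
  also have "\<dots> = (\<Sum>p \<in> set (y # xs) \<rightarrow>\<^sub>E {..<m}. path_weight X (p(x := i)) j (x # y # xs))"
    using Cons.prems(1) by (simp add: sum_PiE_insert)
  finally show ?case .
qed

lemma path_weight_eq_prod:
  assumes "distinct (x # xs)"
    and "\<And>l. l < length xs \<Longrightarrow> s ((x # xs) ! l) = xs ! l" and "s (last (x # xs)) = z"
  shows "path_weight X p (p z) (x # xs) = (\<Prod>t \<in> set (x # xs). X t $$ (p t, p (s t)))"
  using assms
proof (induction xs arbitrary: x)
  case Nil
  then show ?case by simp
next
  case (Cons y xs)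
  have "path_weight X p (p z) (y # xs) = (\<Prod>t \<in> set (y # xs). X t $$ (p t, p (s t)))"
    using Cons.prems(1,3) Cons.prems(2)[of "Suc _"] by (intro Cons.IH) auto
  moreover have "s x = y" using Cons.prems(2)[of 0] by simp
  ultimately show ?case using Cons.prems(1) by simp
qed

text \<open>
  Taking the trace identifies the end state of a path with its first state, so that the path closes
  up along the cycle: every step leads from the label of \<open>t\<close> to the label of \<open>s t\<close>. This form no
  longer mentions where the cycle starts.
\<close>
lemma trace_word_mat_cycle:
  assumes "c \<noteq> []" "distinct c"
    and step: "\<And>l. l < length c \<Longrightarrow> s (c ! l) = c ! (Suc l mod length c)"
    and X: "\<And>t. t \<in> set c \<Longrightarrow> X t \<in> carrier_mat m m"
  shows "trace_mat (word_mat m X c)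
    = (\<Sum>p \<in> set c \<rightarrow>\<^sub>E {..<m}. \<Prod>t \<in> set c. X t $$ (p t, p (s t)))"
proof -
  obtain x xs where c: "c = x # xs" using assms(1) by (cases c) auto
  have "word_mat m X c \<in> carrier_mat m m" using X by (rule word_mat_carrier)
  then have "trace_mat (word_mat m X c) = (\<Sum>i<m. word_mat m X c $$ (i, i))"
    by (simp add: trace_mat_def)
  also have "\<dots> = (\<Sum>i<m. \<Sum>p \<in> set xs \<rightarrow>\<^sub>E {..<m}. path_weight X (p(x := i)) i (x # xs))"
    using assms(2) X unfolding c by (intro sum.cong refl word_mat_entry) auto
  also have "\<dots> = (\<Sum>p \<in> set c \<rightarrow>\<^sub>E {..<m}. path_weight X p (p x) (x # xs))"
    using assms(2) by (simp add: c sum_PiE_insert)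
  also have "\<dots> = (\<Sum>p \<in> set c \<rightarrow>\<^sub>E {..<m}. \<Prod>t \<in> set c. X t $$ (p t, p (s t)))"
  proof (rule sum.cong[OF refl])
    fix p
    have "s ((x # xs) ! l) = xs ! l" if "l < length xs" for l
      using step[of l] that by (simp add: c)
    moreover have "s (last (x # xs)) = x"
      using step[of "length xs"] by (subst last_conv_nth) (simp_all add: c)
    ultimately show "path_weight X p (p x) (x # xs) = (\<Prod>t \<in> set c. X t $$ (p t, p (s t)))"
      using assms(2) unfolding c by (intro path_weight_eq_prod) auto
  qed
  finally show ?thesis .
qed

section \<open>Cycles of a permutation\<close>

lemma support_step:
  assumes "permutation \<sigma>" "l < length (support \<sigma> i)"
  shows "\<sigma> (support \<sigma> i ! l) = support \<sigma> i ! (Suc l mod length (support \<sigma> i))"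
proof (cases "Suc l < least_power \<sigma> i")
  case False
  then have "Suc l = least_power \<sigma> i" using assms(2) by simp
  then have "(\<sigma> ^^ Suc l) i = i" "Suc l mod least_power \<sigma> i = 0"
    using least_power_of_permutation(1)[OF assms(1), of i] by simp_all
  then show ?thesis using assms(2) by simp
qed (use assms(2) in simp)

lemma self_in_support: "permutation \<sigma> \<Longrightarrow> i \<in> set (support \<sigma> i)"
  using least_power_of_permutation(2)[of \<sigma> i] by force

lemma support_eq_hd_tl: "permutation \<sigma> \<Longrightarrow> support \<sigma> i = i # tl (support \<sigma> i)"
  using least_power_of_permutation(2)[of \<sigma> i] by (simp add: upt_conv_Cons)

lemma set_support_eqI:
  assumes "permutation \<sigma>" "x \<in> set (support \<sigma> i)" "x \<in> set (support \<sigma> k)"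
  shows "set (support \<sigma> i) = set (support \<sigma> k)"
proof (rule ccontr)
  assume "set (support \<sigma> i) \<noteq> set (support \<sigma> k)"
  then have "set (support \<sigma> i) \<inter> set (support \<sigma> k) = {}"
    by (intro disjointD[OF disjoint_support[OF assms(1)]] rangeI)
  then show False using assms(2,3) by blast
qed

text \<open>
  Picking the minimum of every cycle that avoids \<open>n\<close>, and \<open>n\<close> itself for the remaining cycle, selects
  each cycle exactly once.
\<close>
lemma cycles_partition:
  assumes \<sigma>: "\<sigma> permutes {1..n}" and n: "n \<ge> 1"
  shows "disjoint_family_on (\<lambda>i. set (support \<sigma> i)) (insert n (cycle_starts n \<sigma>))"
    and "(\<Union>i \<in> insert n (cycle_starts n \<sigma>). set (support \<sigma> i)) = {1..n}"
proof -
  have perm: "permutation \<sigma>" using \<sigma> by (auto simp: permutation_permutes)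
  note self = self_in_support[OF perm] and eqI = set_support_eqI[OF perm]
  have sub: "set (support \<sigma> i) \<subseteq> {1..n}" if "i \<in> {1..n}" for i
    using permutes_in_image[OF permutes_funpow[OF \<sigma>]] that by auto
  show "disjoint_family_on (\<lambda>i. set (support \<sigma> i)) (insert n (cycle_starts n \<sigma>))"
    unfolding disjoint_family_on_def
  proof (intro ballI impI, rule ccontr)
    fix i k assume ik: "i \<in> insert n (cycle_starts n \<sigma>)" "k \<in> insert n (cycle_starts n \<sigma>)" "i \<noteq> k"
    assume "set (support \<sigma> i) \<inter> set (support \<sigma> k) \<noteq> {}"
    then have eq: "set (support \<sigma> i) = set (support \<sigma> k)" using eqI by blast
    have "i \<in> set (support \<sigma> k)" "k \<in> set (support \<sigma> i)" using self eq by blast+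
    then have "i \<in> cycle_starts n \<sigma>" "k \<in> cycle_starts n \<sigma>"
      using ik unfolding cycle_starts_def by blast+
    then have "i \<le> k" "k \<le> i"
      using \<open>i \<in> set (support \<sigma> k)\<close> \<open>k \<in> set (support \<sigma> i)\<close> unfolding cycle_starts_def by blast+
    then show False using ik(3) by simp
  qed
  show "(\<Union>i \<in> insert n (cycle_starts n \<sigma>). set (support \<sigma> i)) = {1..n}"
  proof (intro equalityI subsetI)
    fix t assume "t \<in> (\<Union>i \<in> insert n (cycle_starts n \<sigma>). set (support \<sigma> i))"
    then obtain i where i: "i \<in> insert n (cycle_starts n \<sigma>)" "t \<in> set (support \<sigma> i)" by blast
    then have "i \<in> {1..n}" using n unfolding cycle_starts_def by auto
    then show "t \<in> {1..n}" using sub i(2) by blast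
  next
    fix t assume t: "t \<in> {1..n}"
    show "t \<in> (\<Union>i \<in> insert n (cycle_starts n \<sigma>). set (support \<sigma> i))"
    proof (cases "n \<in> set (support \<sigma> t)")
      case True
      then have "t \<in> set (support \<sigma> n)" using eqI self by blast
      then show ?thesis by blast
    next
      case False
      define i where "i = Min (set (support \<sigma> t))"
      have i: "i \<in> set (support \<sigma> t)" unfolding i_def using self[of t] by (intro Min_in) auto
      then have eq: "set (support \<sigma> i) = set (support \<sigma> t)" using eqI self by blast
      have "i \<le> j" if "j \<in> set (support \<sigma> i)" for j
      proof -
        have "j \<in> set (support \<sigma> t)" using that eq by blast
        then show ?thesis unfolding i_def by (intro Min_le finite_set)
      qed
      moreover have "i \<in> {1..n}" using sub[OF t] i by blast
      moreover have "n \<notin> set (support \<sigma> i)" using False unfolding eq .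
      ultimately have "i \<in> cycle_starts n \<sigma>" unfolding cycle_starts_def by blast
      then show ?thesis using self[of t] eq by blast
    qed
  qed
qed

section \<open>The quadratic form of the matrix-valued function\<close>

definition outer_mat :: "nat \<Rightarrow> complex vec \<Rightarrow> complex mat" where
  "outer_mat m v = mat m m (\<lambda>(i, j). v $ i * cnj (v $ j))"

text \<open>
  This identity turns the open product along the cycle of \<open>n\<close> into a closed one: the form of a product
  at \<open>v\<close> is the trace of the product with \<open>v v\<^sup>*\<close> put in front, so \<open>v v\<^sup>*\<close> plays the part of a matrix
  \<open>X\<^sub>n\<close>.
\<close>
lemma quad_form_eq_trace_outer:
  assumes "W \<in> carrier_mat m m" "v \<in> carrier_vec m"
  shows "(W *\<^sub>v v) \<bullet>c v = trace_mat (outer_mat m v * W)"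
proof -
  have "(W *\<^sub>v v) \<bullet>c v = (\<Sum>j<m. \<Sum>i<m. v $ i * cnj (v $ j) * W $$ (j, i))"
    using assms by (simp add: scalar_prod_def atLeast0LessThan sum_distrib_left sum_distrib_right mult_ac)
  also have "\<dots> = (\<Sum>i<m. \<Sum>j<m. v $ i * cnj (v $ j) * W $$ (j, i))"
    by (rule sum.swap)
  also have "\<dots> = trace_mat (outer_mat m v * W)"
    using assms by (simp add: trace_mat_def outer_mat_def scalar_prod_def atLeast0LessThan)
  finally show ?thesis .
qed

text \<open>
  After setting \<open>X\<^sub>n = v v\<^sup>*\<close>, all cycles contribute traces. Each trace is a sum over labellings of its
  cycle, and as the cycles partition \<open>{1..n}\<close> the product of these sums is one sum over labellings of
  \<open>{1..n}\<close>, in which the cycle structure of \<open>\<sigma>\<close> has disappeared.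
\<close>
lemma quad_form_T_tilde:
  assumes \<sigma>: "\<sigma> permutes {1..n}" and n: "n \<ge> 1"
    and X: "\<And>t. t \<in> {1..n-1} \<Longrightarrow> X t \<in> carrier_mat m m" and v: "v \<in> carrier_vec m"
  shows "T_tilde n m X \<sigma> \<in> carrier_mat m m"
    and "(T_tilde n m X \<sigma> *\<^sub>v v) \<bullet>c v
      = (\<Sum>p \<in> {1..n} \<rightarrow>\<^sub>E {..<m}. \<Prod>t = 1..n. (X(n := outer_mat m v)) t $$ (p t, p (\<sigma> t)))"
proof -
  define Y where "Y = X(n := outer_mat m v)"
  define I where "I = cycle_starts n \<sigma>"
  let ?c = "support \<sigma>"
  have perm: "permutation \<sigma>" using \<sigma> by (auto simp: permutation_permutes)
  have Y: "Y t \<in> carrier_mat m m" if "t \<in> {1..n}" for t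
    using X that by (cases "t = n") (auto simp: Y_def outer_mat_def)
  have disj: "disjoint_family_on (\<lambda>i. set (?c i)) (insert n I)"
    and un: "(\<Union>i \<in> insert n I. set (?c i)) = {1..n}"
    unfolding I_def by (rule cycles_partition[OF \<sigma> n])+
  have nI: "n \<notin> I" using self_in_support[OF perm, of n] unfolding I_def cycle_starts_def by blast
  have fin: "finite I" unfolding I_def cycle_starts_def by simp
  have cn: "?c n = n # tl (?c n)" by (rule support_eq_hd_tl[OF perm])
  have dist: "distinct (?c i)" for i by (rule cycle_of_permutation[OF perm])
  have ntl: "n \<notin> set (tl (?c n))" using dist[of n] cn by (metis distinct.simps(2))
  have sub: "set (?c i) \<subseteq> {1..n}" if "i \<in> insert n I" for i
    using un that by blast
  have tlsub: "set (tl (?c n)) \<subseteq> {1..n}"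
    using sub[of n] cn by (metis insertI1 list.set_intros(2) subset_iff)
  let ?W = "word_mat m X (tl (?c n))"
  have W: "?W = word_mat m Y (tl (?c n))"
    using ntl by (intro word_mat_cong) (auto simp: Y_def)
  have Wc: "?W \<in> carrier_mat m m"
    unfolding W using Y tlsub by (intro word_mat_carrier) blast
  then show "T_tilde n m X \<sigma> \<in> carrier_mat m m" by (simp add: T_tilde_def)
  have traceX: "trace_mat (word_mat m X (?c i)) = trace_mat (word_mat m Y (?c i))" if "i \<in> I" for i
  proof -
    have "n \<notin> set (?c i)" using that unfolding I_def cycle_starts_def by blast
    then have "word_mat m X (?c i) = word_mat m Y (?c i)"
      by (intro word_mat_cong) (metis Y_def fun_upd_other)
    then show ?thesis by simp
  qed
  have "(?W *\<^sub>v v) \<bullet>c v = trace_mat (word_mat m Y (n # tl (?c n)))"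
    unfolding quad_form_eq_trace_outer[OF Wc v] word_mat_Cons W[symmetric] by (simp add: Y_def)
  then have trn: "(?W *\<^sub>v v) \<bullet>c v = trace_mat (word_mat m Y (?c n))"
    unfolding cn[symmetric] .
  have smult: "(a \<cdot>\<^sub>m ?W) *\<^sub>v v = a \<cdot>\<^sub>v (?W *\<^sub>v v)" for a
    using Wc v by (intro eq_vecI) auto
  have "(T_tilde n m X \<sigma> *\<^sub>v v) \<bullet>c v
      = (\<Prod>i\<in>I. trace_mat (word_mat m X (?c i))) * ((?W *\<^sub>v v) \<bullet>c v)"
    unfolding T_tilde_def I_def smult using Wc v
    by (intro smult_scalar_prod_distrib[of _ m]) auto
  also have "\<dots> = (\<Prod>i \<in> insert n I. trace_mat (word_mat m Y (?c i)))"
    unfolding trn using nI fin traceX by (simp add: mult.commute del: list.map)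
  also have "\<dots> = (\<Prod>i \<in> insert n I. \<Sum>p \<in> set (?c i) \<rightarrow>\<^sub>E {..<m}.
      \<Prod>t \<in> set (?c i). Y t $$ (p t, p (\<sigma> t)))"
  proof (rule prod.cong[OF refl])
    fix i assume i: "i \<in> insert n I"
    show "trace_mat (word_mat m Y (?c i))
        = (\<Sum>p \<in> set (?c i) \<rightarrow>\<^sub>E {..<m}. \<Prod>t \<in> set (?c i). Y t $$ (p t, p (\<sigma> t)))"
    proof (rule trace_word_mat_cycle)
      show "?c i \<noteq> []" using self_in_support[OF perm, of i] by (metis empty_iff empty_set)
      show "Y t \<in> carrier_mat m m" if "t \<in> set (?c i)" for t using Y sub[OF i] that by blast
    qed (rule dist, rule support_step[OF perm])
  qed
  also have "\<dots> = (\<Sum>p \<in> (\<Union>i \<in> insert n I. set (?c i)) \<rightarrow>\<^sub>E {..<m}.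
      \<Prod>i \<in> insert n I. \<Prod>t \<in> set (?c i). Y t $$ (p t, p (\<sigma> t)))"
  proof (rule sum_PiE_partition[symmetric])
    show "finite (insert n I)" using fin by simp
    show "disjoint_family_on (\<lambda>i. set (?c i)) (insert n I)" by (rule disj)
    fix i and p q :: "nat \<Rightarrow> nat" assume pq: "\<And>x. x \<in> set (?c i) \<Longrightarrow> p x = q x"
    have "\<sigma> t \<in> set (?c i)" if t: "t \<in> set (?c i)" for t
    proof -
      obtain l where "t = (\<sigma> ^^ l) i"
        using t unfolding support_set[OF perm] by blast
      then have "\<sigma> t = (\<sigma> ^^ Suc l) i" by simp
      then show ?thesis unfolding support_set[OF perm] by blast
    qed
    then show "(\<Prod>t \<in> set (?c i). Y t $$ (p t, p (\<sigma> t))) = (\<Prod>t \<in> set (?c i). Y t $$ (q t, q (\<sigma> t)))"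
      using pq by (intro prod.cong refl) metis
  qed
  also have "\<dots> = (\<Sum>p \<in> {1..n} \<rightarrow>\<^sub>E {..<m}. \<Prod>t = 1..n. Y t $$ (p t, p (\<sigma> t)))"
  proof -
    have "(\<Prod>i \<in> insert n I. \<Prod>t \<in> set (?c i). g t) = (\<Prod>t = 1..n. g t)" for g :: "nat \<Rightarrow> complex"
      unfolding un[symmetric] using fin disj
      by (intro prod.UNION_disjoint[symmetric]) (auto simp: disjoint_family_on_def)
    then show ?thesis unfolding un by simp
  qed
  finally show "(T_tilde n m X \<sigma> *\<^sub>v v) \<bullet>c v
      = (\<Sum>p \<in> {1..n} \<rightarrow>\<^sub>E {..<m}. \<Prod>t = 1..n. (X(n := outer_mat m v)) t $$ (p t, p (\<sigma> t)))"
    unfolding Y_def .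
qed

lemma finsum_module_mat:
  assumes "finite I" and "\<And>i. i \<in> I \<Longrightarrow> M i \<in> carrier_mat r c"
  shows "(\<Oplus>\<^bsub>module_mat TYPE('a :: comm_ring_1) r c\<^esub> i \<in> I. M i) \<in> carrier_mat r c \<and>
    (\<forall>a<r. \<forall>b<c. (\<Oplus>\<^bsub>module_mat TYPE('a) r c\<^esub> i \<in> I. M i) $$ (a, b) = (\<Sum>i\<in>I. M i $$ (a, b)))"
  using assms
proof (induction I rule: finite_induct)
  interpret abelian_group "module_mat TYPE('a) r c" by (rule abelian_group_mat)
  {
    case empty
    then show ?case by (simp add: module_mat_simps)
  next
    case (insert i I)
    have "(\<Oplus>\<^bsub>module_mat TYPE('a) r c\<^esub> i \<in> insert i I. M i)
        = M i + (\<Oplus>\<^bsub>module_mat TYPE('a) r c\<^esub> i \<in> I. M i)"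
      using insert.hyps insert.prems
      by (subst finsum_insert) (auto simp: module_mat_simps)
    moreover have "(\<Oplus>\<^bsub>module_mat TYPE('a) r c\<^esub> i \<in> I. M i) \<in> carrier_mat r c"
      using insert by blast
    ultimately show ?case using insert by (auto simp: carrier_matD)
  }
qed

lemma quad_form_d_tilde:
  assumes "n \<ge> 1" and X: "\<And>t. t \<in> {1..n-1} \<Longrightarrow> X t \<in> carrier_mat m m" and v: "v \<in> carrier_vec m"
  shows "d_tilde n m f X \<in> carrier_mat m m"
    and "(d_tilde n m f X *\<^sub>v v) \<bullet>c v
      = (\<Sum>\<sigma> | \<sigma> permutes {1..n}. f \<sigma> * ((T_tilde n m X \<sigma> *\<^sub>v v) \<bullet>c v))"
proof -
  let ?S = "{\<sigma>. \<sigma> permutes {1..n}}"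
  have fin: "finite ?S" by (rule finite_permutations) simp
  have T: "T_tilde n m X \<sigma> \<in> carrier_mat m m" if "\<sigma> \<in> ?S" for \<sigma>
    using that by (intro quad_form_T_tilde(1)[OF _ assms(1) X v]) auto
  then have D: "d_tilde n m f X \<in> carrier_mat m m \<and>
      (\<forall>a<m. \<forall>b<m. d_tilde n m f X $$ (a, b) = (\<Sum>\<sigma>\<in>?S. (f \<sigma> \<cdot>\<^sub>m T_tilde n m X \<sigma>) $$ (a, b)))"
    unfolding d_tilde_def by (intro finsum_module_mat fin) auto
  then show Dc: "d_tilde n m f X \<in> carrier_mat m m" by blast
  have entry: "d_tilde n m f X $$ (a, b) = (\<Sum>\<sigma>\<in>?S. f \<sigma> * T_tilde n m X \<sigma> $$ (a, b))"
    if "a < m" "b < m" for a b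
    using D that carrier_matD[OF T] by simp
  have vv: "v = vec m (($) v)" using v by auto
  have form: "(A *\<^sub>v v) \<bullet>c v = (\<Sum>i<m. \<Sum>j<m. cnj (v $ i) * A $$ (i, j) * v $ j)"
    if "A \<in> carrier_mat m m" for A
    using quad_form_entries[OF that, of "($) v"] vv by simp
  have "(d_tilde n m f X *\<^sub>v v) \<bullet>c v
      = (\<Sum>i<m. \<Sum>j<m. \<Sum>\<sigma>\<in>?S. f \<sigma> * (cnj (v $ i) * T_tilde n m X \<sigma> $$ (i, j) * v $ j))"
    unfolding form[OF Dc] by (simp add: entry sum_distrib_left sum_distrib_right mult_ac)
  also have "\<dots> = (\<Sum>\<sigma>\<in>?S. f \<sigma> * (\<Sum>i<m. \<Sum>j<m. cnj (v $ i) * T_tilde n m X \<sigma> $$ (i, j) * v $ j))"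
    unfolding sum_distrib_left by (subst sum.swap[of _ ?S], subst sum.swap[of _ ?S]) (rule refl)
  also have "\<dots> = (\<Sum>\<sigma>\<in>?S. f \<sigma> * ((T_tilde n m X \<sigma> *\<^sub>v v) \<bullet>c v))"
    by (intro sum.cong refl) (simp only: form T)
  finally show "(d_tilde n m f X *\<^sub>v v) \<bullet>c v
      = (\<Sum>\<sigma> | \<sigma> permutes {1..n}. f \<sigma> * ((T_tilde n m X \<sigma> *\<^sub>v v) \<bullet>c v))" .
qed

theorem theorem2:
  fixes n :: nat and f :: "(nat \<Rightarrow> nat) \<Rightarrow> complex"
  assumes "n \<ge> 1"
    and "\<And>A. psd_mat n A \<Longrightarrow> 0 \<le> gen_mat_fun n f A"
  shows "\<forall>m \<ge> 1. \<forall>X :: nat \<Rightarrow> complex mat.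
    (\<forall>i \<in> {1..n-1}. psd_mat m (X i)) \<longrightarrow> psd_mat m (d_tilde n m f X)"
proof (intro allI impI)
  fix m :: nat and X :: "nat \<Rightarrow> complex mat"
  assume X: "\<forall>i \<in> {1..n-1}. psd_mat m (X i)"
  have Xc: "X t \<in> carrier_mat m m" if "t \<in> {1..n-1}" for t
    using X that by (auto simp: psd_mat_def)
  show "psd_mat m (d_tilde n m f X)"
  proof (rule psd_matI)
    show "d_tilde n m f X \<in> carrier_mat m m"
      by (rule quad_form_d_tilde(1)[OF assms(1) Xc zero_carrier_vec])
  next
    fix v :: "complex vec" assume v: "v \<in> carrier_vec m"
    define Y where "Y = X(n := outer_mat m v)"
    have "\<exists>u. \<forall>i<m. \<forall>j<m. Y t $$ (i, j) = (\<Sum>k<m. u k i * cnj (u k j))" if "t \<in> {1..n}" for t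
    proof (cases "t = n")
      case True
      \<comment> \<open>A single rank one term, padded with zero vectors to the number \<open>m\<close> used for the others.\<close>
      define u where "u k i = (if k = 0 then v $ i else 0)" for k i :: nat
      have "Y t $$ (i, j) = (\<Sum>k<m. u k i * cnj (u k j))" if "i < m" "j < m" for i j
      proof -
        have "(\<Sum>k<m. u k i * cnj (u k j)) = (\<Sum>k<m. if k = 0 then v $ i * cnj (v $ j) else 0)"
          by (intro sum.cong) (auto simp: u_def)
        then show ?thesis using that True by (simp add: Y_def outer_mat_def)
      qed
      then show ?thesis by blast
    next
      case False
      then have "t \<in> {1..n-1}" using that by auto
      then show ?thesis
        using X False unfolding Y_def by (simp add: psd_mat_sum_rank_one)
    qed
    then obtain u where u: "\<And>t i j. t \<in> {1..n} \<Longrightarrow> i < m \<Longrightarrow> j < m \<Longrightarrow>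
        Y t $$ (i, j) = (\<Sum>k<m. u t k i * cnj (u t k j))"
      by metis
    define A where "A k = gram_mat n m (\<lambda>t. u t (k t))" for k
    let ?P = "{1..n} \<rightarrow>\<^sub>E {..<m}"
    have "(d_tilde n m f X *\<^sub>v v) \<bullet>c v
        = (\<Sum>\<sigma> | \<sigma> permutes {1..n}. f \<sigma> * ((T_tilde n m X \<sigma> *\<^sub>v v) \<bullet>c v))"
      by (intro quad_form_d_tilde(2) assms(1) Xc v)
    also have "\<dots> = (\<Sum>\<sigma> | \<sigma> permutes {1..n}.
        f \<sigma> * (\<Sum>p \<in> ?P. \<Prod>t = 1..n. Y t $$ (p t, p (\<sigma> t))))"
      unfolding Y_def
      by (intro sum.cong refl arg_cong2[where f = "(*)"] quad_form_T_tilde(2)[OF _ assms(1) Xc v]) auto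
    also have "\<dots> = (\<Sum>\<sigma> | \<sigma> permutes {1..n}.
        f \<sigma> * (\<Sum>k \<in> ?P. \<Prod>t = 1..n. A k $$ (t - 1, \<sigma> t - 1)))"
      unfolding A_def
      by (intro sum.cong refl arg_cong2[where f = "(*)"] sum_paths_eq_sum_gram u) auto
    also have "\<dots> = (\<Sum>k \<in> ?P. gen_mat_fun n f (A k))"
      unfolding gen_mat_fun_def sum_distrib_left by (rule sum.swap)
    also have "0 \<le> \<dots>"
      unfolding A_def by (intro sum_nonneg assms(2) psd_gram_mat)
    finally show "0 \<le> (d_tilde n m f X *\<^sub>v v) \<bullet>c v" .
  qed
qed

end
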